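(* Let $n\ge 1$ and $\rho\ge0$ be integers. Let $G_0\in\mathbb{R}^{n\times n}$ be symmetric positive definite, and for $k=0,\dots,\rho$ let $Q_{k+1}\in\mathbb{R}^{n\times n}$ be symmetric and $\mathcal{S}_k\in\mathbb{R}^{n\times q_k}$ be such that $\mathcal{S}_k^TQ_{k+1}\mathcal{S}_k$ is positive definite. Define, for $k=0,\dots,\rho$, $$G_{k+1}=Q_{k+1}\Pi_kQ_{k+1}+(I-Q_{k+1}\Pi_k)\,G_k\,(I-\Pi_kQ_{k+1}),\qquad \Pi_k:=\mathcal{S}_k(\mathcal{S}_k^TQ_{k+1}\mathcal{S}_k)^{-1}\mathcal{S}_k^T .$$ Then $G_k$ is positive definite for $k=0,\dots,\rho+1$.
   Context: $I$ denotes the $n\times n$ identity matrix. The recursion for $G_{k+1}$ is called the quNac (quasi-Newton action constrained) update. The matrices $Q_{k+1}$ need not be positive definite. *)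

theory Defs
  imports "Jordan_Normal_Form.Gauss_Jordan_Elimination"
begin

(* Positive definiteness of a real matrix includes symmetry, which also forces the matrix
   to be square. *)
definition pos_def_mat :: "real mat \<Rightarrow> bool" where
  "pos_def_mat A \<longleftrightarrow>
     transpose_mat A = A \<and>
     (\<forall>x \<in> carrier_vec (dim_row A). x \<noteq> 0\<^sub>v (dim_row A) \<longrightarrow> x \<bullet> (A *\<^sub>v x) > 0)"

(* Arbitrary value if A is not invertible. *)
definition mat_inv :: "real mat \<Rightarrow> real mat" where
  "mat_inv A = the (mat_inverse A)"

definition quNac_Pi :: "real mat \<Rightarrow> real mat \<Rightarrow> real mat" where
  "quNac_Pi S Q = S * mat_inv (transpose_mat S * Q * S) * transpose_mat S"

definition quNac_update :: "real mat \<Rightarrow> real mat \<Rightarrow> real mat \<Rightarrow> real mat" where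
  "quNac_update Q S G =
     Q * quNac_Pi S Q * Q
     + (1\<^sub>m (dim_row Q) - Q * quNac_Pi S Q) * G * (1\<^sub>m (dim_row Q) - quNac_Pi S Q * Q)"

end

theory Submission
  imports Defs "Jordan_Normal_Form.Determinant"
begin

text \<open>
  Consider one update \<open>G'\<close> of \<open>G\<close>, with \<open>M = S\<^sup>T Q S\<close> and \<open>\<Pi> = S M\<^sup>-\<^sup>1 S\<^sup>T\<close>.  Since \<open>Q\<close> and
  \<open>\<Pi>\<close> are symmetric, \<open>G'\<close> equals
  \<open>(S\<^sup>T Q)\<^sup>T M\<^sup>-\<^sup>1 (S\<^sup>T Q) + (I - \<Pi> Q)\<^sup>T G (I - \<Pi> Q)\<close>, a sum of congruences of the two positive
  definite matrices \<open>M\<^sup>-\<^sup>1\<close> (\<open>pos_def_mat_inv\<close>) and \<open>G\<close>.  Such a sum is positive definite as soon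
  as no nonzero vector is annihilated by both congruence factors (\<open>pos_def_mat_sum_congruences\<close>).
  Here \<open>S\<^sup>T Q x = 0\<close> gives \<open>\<Pi> Q x = S M\<^sup>-\<^sup>1 (S\<^sup>T Q x) = 0\<close>, hence \<open>(I - \<Pi> Q) x = x\<close>, so a
  common null vector must vanish (\<open>quNac_update_pos_def\<close>).  The theorem follows by
  induction on \<open>k\<close>.
\<close>

lemma scalar_prod_congruence:
  fixes A B :: "real mat"
  assumes A: "A \<in> carrier_mat m n" and B: "B \<in> carrier_mat m m" and x: "x \<in> carrier_vec n"
  shows "x \<bullet> ((transpose_mat A * B * A) *\<^sub>v x) = (A *\<^sub>v x) \<bullet> (B *\<^sub>v (A *\<^sub>v x))"
proof -
  have Ax: "A *\<^sub>v x \<in> carrier_vec m" and BAx: "B *\<^sub>v (A *\<^sub>v x) \<in> carrier_vec m"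
    using A B x by auto
  have AtB: "transpose_mat A * B \<in> carrier_mat n m" and At: "transpose_mat A \<in> carrier_mat n m"
    using A B by auto
  have "(transpose_mat A * B * A) *\<^sub>v x = transpose_mat A *\<^sub>v (B *\<^sub>v (A *\<^sub>v x))"
    by (simp add: assoc_mult_mat_vec[OF AtB A x] assoc_mult_mat_vec[OF At B Ax])
  then have "x \<bullet> ((transpose_mat A * B * A) *\<^sub>v x) = (transpose_mat A *\<^sub>v (B *\<^sub>v (A *\<^sub>v x))) \<bullet> x"
    using comm_scalar_prod[of x n] x At BAx by simp
  also have "\<dots> = (B *\<^sub>v (A *\<^sub>v x)) \<bullet> (A *\<^sub>v x)"
    by (rule transpose_vec_mult_scalar[OF A x BAx])
  finally show ?thesis
    using comm_scalar_prod[OF BAx Ax] by simp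
qed

lemma transpose_congruence:
  fixes A B :: "real mat"
  assumes A: "A \<in> carrier_mat m n" and B: "B \<in> carrier_mat m m" and sym: "transpose_mat B = B"
  shows "transpose_mat (transpose_mat A * B * A) = transpose_mat A * B * A"
proof -
  have At: "transpose_mat A \<in> carrier_mat n m"
    using A by simp
  have AtB: "transpose_mat A * B \<in> carrier_mat n m"
    using At B by simp
  have "transpose_mat (transpose_mat A * B * A) = transpose_mat A * (B * A)"
    by (simp add: transpose_mult[OF AtB A] transpose_mult[OF At B] sym)
  then show ?thesis
    using assoc_mult_mat[OF At B A] by simp
qed

lemma pos_def_mat_nonneg:
  assumes "pos_def_mat A" and "A \<in> carrier_mat n n" and "x \<in> carrier_vec n"
  shows "x \<bullet> (A *\<^sub>v x) \<ge> 0"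
  using assms unfolding pos_def_mat_def
  by (cases "x = 0\<^sub>v n") (auto simp: less_imp_le)

text \<open>
  The quadratic form of the sum at \<open>x\<close> splits into the form of \<open>B\<close> at \<open>A x\<close> and the form of \<open>G\<close>
  at \<open>C x\<close>.  Both are nonnegative, and for \<open>x \<noteq> 0\<close> one of the two arguments is nonzero.
\<close>
lemma pos_def_mat_sum_congruences:
  assumes A: "A \<in> carrier_mat m n" and B: "B \<in> carrier_mat m m"
    and C: "C \<in> carrier_mat p n" and G: "G \<in> carrier_mat p p"
    and pdB: "pos_def_mat B" and pdG: "pos_def_mat G"
    and ker: "\<And>x. x \<in> carrier_vec n \<Longrightarrow> A *\<^sub>v x = 0\<^sub>v m \<Longrightarrow> C *\<^sub>v x = 0\<^sub>v p \<Longrightarrow> x = 0\<^sub>v n"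
  shows "pos_def_mat (transpose_mat A * B * A + transpose_mat C * G * C)"
  unfolding pos_def_mat_def
proof (intro conjI ballI impI)
  let ?X = "transpose_mat A * B * A" and ?Y = "transpose_mat C * G * C"
  have X: "?X \<in> carrier_mat n n" and Y: "?Y \<in> carrier_mat n n"
    using A B C G by auto
  have "transpose_mat B = B" and "transpose_mat G = G"
    using pdB pdG by (auto simp: pos_def_mat_def)
  then show "transpose_mat (?X + ?Y) = ?X + ?Y"
    using transpose_add[OF X Y] transpose_congruence[OF A B] transpose_congruence[OF C G] by simp
  fix x :: "real vec" assume "x \<in> carrier_vec (dim_row (?X + ?Y))" and "x \<noteq> 0\<^sub>v (dim_row (?X + ?Y))"
  then have x: "x \<in> carrier_vec n" and nz: "x \<noteq> 0\<^sub>v n"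
    using X Y by (auto simp: C)
  have Ax: "A *\<^sub>v x \<in> carrier_vec m" and Cx: "C *\<^sub>v x \<in> carrier_vec p"
    using A C x by auto
  have "x \<bullet> ((?X + ?Y) *\<^sub>v x) = x \<bullet> (?X *\<^sub>v x) + x \<bullet> (?Y *\<^sub>v x)"
    using add_mult_distrib_mat_vec[OF X Y x] scalar_prod_add_distrib[OF x] X Y x
    by (metis mult_mat_vec_carrier)
  then have eq: "x \<bullet> ((?X + ?Y) *\<^sub>v x)
      = (A *\<^sub>v x) \<bullet> (B *\<^sub>v (A *\<^sub>v x)) + (C *\<^sub>v x) \<bullet> (G *\<^sub>v (C *\<^sub>v x))"
    by (simp add: scalar_prod_congruence[OF A B x] scalar_prod_congruence[OF C G x])
  have "A *\<^sub>v x \<noteq> 0\<^sub>v m \<or> C *\<^sub>v x \<noteq> 0\<^sub>v p"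
    using ker x nz by blast
  then have "(A *\<^sub>v x) \<bullet> (B *\<^sub>v (A *\<^sub>v x)) > 0 \<or> (C *\<^sub>v x) \<bullet> (G *\<^sub>v (C *\<^sub>v x)) > 0"
    using pdB pdG B G Ax Cx by (auto simp: pos_def_mat_def)
  then show "x \<bullet> ((?X + ?Y) *\<^sub>v x) > 0"
    using eq pos_def_mat_nonneg[OF pdB B Ax] pos_def_mat_nonneg[OF pdG G Cx] by linarith
qed

text \<open>
  A null vector \<open>v \<noteq> 0\<close> of \<open>M\<close> would give \<open>v \<bullet> M v = 0\<close>; so the determinant is nonzero and
  \<open>mat_inv\<close>, which is unspecified on singular matrices, returns the actual inverse.
\<close>
lemma pos_def_mat_inv_inverse:
  assumes M: "M \<in> carrier_mat m m" and pd: "pos_def_mat M"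
  shows "mat_inv M \<in> carrier_mat m m" and "M * mat_inv M = 1\<^sub>m m" and "mat_inv M * M = 1\<^sub>m m"
proof -
  have "det M \<noteq> 0"
  proof
    assume "det M = 0"
    then obtain v where v: "v \<in> carrier_vec m" "v \<noteq> 0\<^sub>v m" "M *\<^sub>v v = 0\<^sub>v m"
      using det_0_iff_vec_prod_zero_field[OF M] by auto
    then have "v \<bullet> (M *\<^sub>v v) > 0"
      using pd M by (auto simp: pos_def_mat_def)
    with v show False by simp
  qed
  then have "M \<in> Units (ring_mat TYPE(real) m ())"
    by (rule det_non_zero_imp_unit[OF M])
  then obtain N where N: "mat_inverse M = Some N"
    using mat_inverse(1)[OF M, of "()"] by (cases "mat_inverse M") auto
  then show "mat_inv M \<in> carrier_mat m m" "M * mat_inv M = 1\<^sub>m m" "mat_inv M * M = 1\<^sub>m m"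
    using mat_inverse(2)[OF M N] by (auto simp: mat_inv_def)
qed

text \<open>
  With \<open>B = M\<^sup>-\<^sup>1\<close>, symmetry of \<open>M\<close> makes \<open>B\<^sup>T\<close> a left inverse of \<open>M\<close> as well, so \<open>B\<^sup>T = B\<close> and
  \<open>B = B\<^sup>T M B\<close>: the inverse is itself a congruence of \<open>M\<close>, by an injective matrix.
\<close>
lemma pos_def_mat_inv:
  assumes M: "M \<in> carrier_mat m m" and pd: "pos_def_mat M"
  shows "pos_def_mat (mat_inv M)"
proof -
  let ?B = "mat_inv M"
  note B = pos_def_mat_inv_inverse[OF M pd]
  have sym: "transpose_mat M = M"
    using pd by (simp add: pos_def_mat_def)
  have Bt: "transpose_mat ?B \<in> carrier_mat m m"
    using B(1) by simp
  have "transpose_mat ?B * M = 1\<^sub>m m"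
    using transpose_mult[OF M B(1)] B(2) sym by simp
  then have symB: "transpose_mat ?B = ?B"
    using assoc_mult_mat[OF Bt M B(1)] B Bt by simp
  have eq: "transpose_mat ?B * M * ?B = ?B"
    using B \<open>transpose_mat ?B * M = 1\<^sub>m m\<close> by simp
  show ?thesis
    unfolding pos_def_mat_def
  proof (intro conjI ballI impI)
    fix x :: "real vec" assume "x \<in> carrier_vec (dim_row ?B)" and "x \<noteq> 0\<^sub>v (dim_row ?B)"
    then have x: "x \<in> carrier_vec m" and nz: "x \<noteq> 0\<^sub>v m"
      using B(1) by auto
    have "M *\<^sub>v (?B *\<^sub>v x) = x"
      using assoc_mult_mat_vec[OF M B(1) x] B(2) x by simp
    moreover have "M *\<^sub>v 0\<^sub>v m = 0\<^sub>v m"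
      using M by auto
    ultimately have "?B *\<^sub>v x \<noteq> 0\<^sub>v m"
      using nz by metis
    moreover have "?B *\<^sub>v x \<in> carrier_vec m"
      using B(1) x by simp
    ultimately have "(?B *\<^sub>v x) \<bullet> (M *\<^sub>v (?B *\<^sub>v x)) > 0"
      using pd M by (auto simp: pos_def_mat_def)
    then show "x \<bullet> (?B *\<^sub>v x) > 0"
      using scalar_prod_congruence[OF B(1) M x] eq by simp
  qed (rule symB)
qed

text \<open>
  In the proof \<open>A = S\<^sup>T Q\<close> and \<open>C = I - \<Pi> Q\<close> are the congruence factors; their common null space is
  trivial because \<open>\<Pi> Q\<close> factors through \<open>A\<close>.
\<close>
lemma quNac_update_pos_def:
  assumes Q: "Q \<in> carrier_mat n n" and symQ: "transpose_mat Q = Q"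
    and S: "S \<in> carrier_mat n m" and pdM: "pos_def_mat (transpose_mat S * Q * S)"
    and G: "G \<in> carrier_mat n n" and pdG: "pos_def_mat G"
  shows "quNac_update Q S G \<in> carrier_mat n n" and "pos_def_mat (quNac_update Q S G)"
proof -
  define B where "B = mat_inv (transpose_mat S * Q * S)"
  define P where "P = quNac_Pi S Q"
  define A where "A = transpose_mat S * Q"
  define C where "C = 1\<^sub>m n - P * Q"
  have M: "transpose_mat S * Q * S \<in> carrier_mat m m"
    using S Q by simp
  have B: "B \<in> carrier_mat m m" and pdB: "pos_def_mat B"
    unfolding B_def using pos_def_mat_inv_inverse(1)[OF M pdM] pos_def_mat_inv[OF M pdM] by auto
  have symB: "transpose_mat B = B"
    using pdB by (simp add: pos_def_mat_def)
  have St: "transpose_mat S \<in> carrier_mat m n"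
    using S by simp
  have P_eq: "P = S * B * transpose_mat S"
    by (simp add: P_def quNac_Pi_def B_def)
  have P: "P \<in> carrier_mat n n"
    using S B by (simp add: P_eq)
  have symP: "transpose_mat P = P"
    using transpose_congruence[OF St B symB] by (simp add: P_eq)
  have A: "A \<in> carrier_mat m n"
    using S Q by (simp add: A_def)
  have C: "C \<in> carrier_mat n n"
    using P Q by (auto simp: C_def intro!: minus_carrier_mat)
  have At: "transpose_mat A = Q * S"
    using transpose_mult[OF St Q] symQ by (simp add: A_def)
  have PQ: "P * Q = S * B * A"
    using assoc_mult_mat[of "S * B" n m "transpose_mat S" n Q n] S B Q
    by (simp add: P_eq A_def)
  have first: "transpose_mat A * B * A = Q * P * Q"
  proof -
    have "transpose_mat A * B * A = Q * (S * B) * A"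
      using assoc_mult_mat[OF Q S B] by (simp add: At)
    also have "\<dots> = Q * (P * Q)"
      using assoc_mult_mat[of Q n n "S * B" m A n] Q S B A by (simp add: PQ)
    finally show ?thesis
      using assoc_mult_mat[OF Q P Q] by simp
  qed
  have Ct: "transpose_mat C = 1\<^sub>m n - Q * P"
    using transpose_minus[of "1\<^sub>m n" n n "P * Q"] transpose_mult[OF P Q] P Q symP symQ
    by (simp add: C_def)
  have upd: "quNac_update Q S G = transpose_mat A * B * A + transpose_mat C * G * C"
    using Q unfolding first Ct unfolding quNac_update_def P_def C_def by simp
  then show "quNac_update Q S G \<in> carrier_mat n n"
    using A B C G by auto
  show "pos_def_mat (quNac_update Q S G)"
    unfolding upd
  proof (rule pos_def_mat_sum_congruences[OF A B C G pdB pdG])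
    fix x :: "real vec" assume x: "x \<in> carrier_vec n" and Ax: "A *\<^sub>v x = 0\<^sub>v m" and Cx: "C *\<^sub>v x = 0\<^sub>v n"
    have SB: "S * B \<in> carrier_mat n m"
      using S B by simp
    have zero: "W *\<^sub>v 0\<^sub>v m = 0\<^sub>v n" if "W \<in> carrier_mat n m" for W :: "real mat"
      using that by auto
    have "(P * Q) *\<^sub>v x = (S * B) *\<^sub>v 0\<^sub>v m"
      using assoc_mult_mat_vec[OF SB A x] Ax by (simp add: PQ)
    also have "\<dots> = 0\<^sub>v n"
      using zero[OF SB] .
    finally have "(P * Q) *\<^sub>v x = 0\<^sub>v n" .
    then have "C *\<^sub>v x = x"
      using minus_mult_distrib_mat_vec[of "1\<^sub>m n" n n "P * Q" x] P Q x by (simp add: C_def)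
    with Cx show "x = 0\<^sub>v n" by simp
  qed
qed

theorem proposition2p2:
  fixes n \<rho> :: nat
    and q :: "nat \<Rightarrow> nat"
    and G Q S :: "nat \<Rightarrow> real mat"
  assumes "n \<ge> 1"
    and "G 0 \<in> carrier_mat n n"
    and "pos_def_mat (G 0)"
    and "\<And>k. k \<le> \<rho> \<Longrightarrow> Q (k + 1) \<in> carrier_mat n n"
    and "\<And>k. k \<le> \<rho> \<Longrightarrow> transpose_mat (Q (k + 1)) = Q (k + 1)"
    and "\<And>k. k \<le> \<rho> \<Longrightarrow> S k \<in> carrier_mat n (q k)"
    and "\<And>k. k \<le> \<rho> \<Longrightarrow> pos_def_mat (transpose_mat (S k) * Q (k + 1) * S k)"
    and "\<And>k. k \<le> \<rho> \<Longrightarrow> G (k + 1) = quNac_update (Q (k + 1)) (S k) (G k)"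
  shows "\<forall>k \<le> \<rho> + 1. G k \<in> carrier_mat n n \<and> pos_def_mat (G k)"
proof (intro allI impI)
  fix k assume "k \<le> \<rho> + 1"
  then show "G k \<in> carrier_mat n n \<and> pos_def_mat (G k)"
  proof (induction k)
    case 0
    show ?case using assms(2,3) by simp
  next
    case (Suc k)
    then have k: "k \<le> \<rho>" and IH: "G k \<in> carrier_mat n n" "pos_def_mat (G k)" by auto
    have "G (k + 1) \<in> carrier_mat n n \<and> pos_def_mat (G (k + 1))"
      unfolding assms(8)[OF k]
      using quNac_update_pos_def[OF assms(4)[OF k] assms(5)[OF k] assms(6)[OF k] assms(7)[OF k] IH]
      by simp
    then show ?case by simp
  qed
qed

end
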